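(* Let $\varepsilon,\mu,\sigma$ be bounded, strictly positive real scalar fields on $\Omega$ and let $\varepsilon_c(\mathbf{x})=\varepsilon(\mathbf{x})+i\sigma(\mathbf{x})/\omega=|\varepsilon_c(\mathbf{x})|e^{i\varphi_\varepsilon(\mathbf{x})}$ with $\varphi_\varepsilon(\mathbf{x})\in\,]0,\pi/2[$, where the material fields $\varepsilon_c$ and $\mu$ are elliptic. Consider the sesquilinear form of the Dirichlet and Neumann problems $$a(\mathbf{u},\mathbf{v})=(\mu^{-1}\,\mathbf{curl}\,\mathbf{u},\mathbf{curl}\,\mathbf{v})_\Omega-\omega^2(\varepsilon_c\mathbf{u},\mathbf{v})_\Omega$$ on $\mathbf{H}_0(\mathbf{curl},\Omega)$ (Dirichlet) or $\mathbf{H}(\mathbf{curl},\Omega)$ (Neumann). If $\varphi_\varepsilon(\mathbf{x})\in[\varphi_{\varepsilon,-},\varphi_{\varepsilon,+}]$ a.e. in $\Omega$ with $0<\varphi_{\varepsilon,-}\le\varphi_{\varepsilon,+}<\pi/2$, then $a$ is coercive for every coercivity direction $\theta_{\mathrm{coe}}\in\Theta_{\mathrm{coe}}:=\Theta_{\varepsilon_c}\cap\Theta_{-\mu^{-1}}$, and $$\Theta_{\mathrm{coe}}\supseteq\,\big]-\pi/2-\varphi_{\varepsilon,-},\,-\pi/2\big[.$$ In addition, the equality holds if $\varphi_{\varepsilon,-}=\min_{\mathbf{x}\in\Omega}\varphi_\varepsilon(\mathbf{x})$.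
   Context: $\Omega\subset\mathbb{R}^3$ is an open, connected, bounded set with Lipschitz boundary $\Gamma$ and unit outward normal $\mathbf{n}$; $\omega>0$ is a real constant; $i$ is the imaginary unit. $(\mathbf{a},\mathbf{b})_\Omega=\int_\Omega\mathbf{a}\cdot\overline{\mathbf{b}}\,d\mathbf{x}$. $\mathbf{H}(\mathbf{curl},\Omega)=\{\mathbf{v}\in\mathbf{L}^2(\Omega):\mathbf{curl}\,\mathbf{v}\in\mathbf{L}^2(\Omega)\}$ (complex-valued fields) with norm $\|\mathbf{v}\|^2_{\mathbf{H}(\mathbf{curl},\Omega)}=\|\mathbf{v}\|^2_{\mathbf{L}^2(\Omega)}+\|\mathbf{curl}\,\mathbf{v}\|^2_{\mathbf{L}^2(\Omega)}$; $\mathbf{H}_0(\mathbf{curl},\Omega)$ is its subspace of fields with $(\mathbf{v}\times\mathbf{n})|_\Gamma=0$. A complex scalar field $\xi\in L^\infty(\Omega)$ is elliptic if there exist $\theta\in\mathbb{R}$ and $\xi_->0$ with $\mathrm{Re}\{e^{i\theta}\xi(\mathbf{x})\}\ge\xi_-$ for a.e. $\mathbf{x}\in\Omega$; such a $\theta$ is an ellipticity direction and $\Theta_\xi$ is the set of all ellipticity directions of $\xi$ in $[-\pi,\pi]$. A sesquilinear form $a$ on a Hilbert space $V$ is coercive for the direction $\theta_{\mathrm{coe}}\in\mathbb{R}$ if there exists $C_{\mathrm{coe}}>0$ such that $\mathrm{Re}\{-e^{i\theta_{\mathrm{coe}}}a(\mathbf{u},\mathbf{u})\}\ge C_{\mathrm{coe}}\|\mathbf{u}\|_V^2$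 for all $\mathbf{u}\in V$. Open intervals are written $]a,b[$.
   Formalization: In the equality claim, the minimum of φ_ε over Ω is taken as the essential infimum (not necessarily attained); with a literal pointwise minimum the claim fails, since changing φ_ε at a single point lowers the minimum without changing Θ_coe. *)

theory Defs
  imports "HOL-Analysis.Analysis" "HOL-Probability.Essential_Supremum"
begin

text \<open>Boundary locally the graph of a Lipschitz function, with the domain on one side of it.\<close>

definition lipschitz_boundary :: "(real^3) set \<Rightarrow> bool" where
  "lipschitz_boundary \<Omega> \<longleftrightarrow>
     (\<forall>p\<in>frontier \<Omega>. \<exists>Q :: real^3 \<Rightarrow> real^3. \<exists>g :: real^2 \<Rightarrow> real. \<exists>L r.
        orthogonal_transformation Q \<and> L-lipschitz_on UNIV g \<and> r > 0 \<and>
        (\<forall>y\<in>ball p r. y \<in> \<Omega> \<longleftrightarrow>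
           Q (y - p) $ 3 < g (vector [Q (y - p) $ 1, Q (y - p) $ 2])))"

definition Linf :: "(real^3) set \<Rightarrow> (real^3 \<Rightarrow> 'a::real_normed_vector) set" where
  "Linf \<Omega> = {f. f \<in> borel_measurable (lebesgue_on \<Omega>) \<and>
                (\<exists>C. AE x in lebesgue_on \<Omega>. norm (f x) \<le> C)}"

definition L2 :: "(real^3) set \<Rightarrow> (real^3 \<Rightarrow> complex^3) set" where
  "L2 \<Omega> = {v. v \<in> borel_measurable (lebesgue_on \<Omega>) \<and>
              integrable (lebesgue_on \<Omega>) (\<lambda>x. (norm (v x))\<^sup>2)}"

definition L2_norm :: "(real^3) set \<Rightarrow> (real^3 \<Rightarrow> complex^3) \<Rightarrow> real" where
  "L2_norm \<Omega> v = sqrt (LINT x|lebesgue_on \<Omega>. (norm (v x))\<^sup>2)"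

definition L2_inner :: "(real^3) set \<Rightarrow> (real^3 \<Rightarrow> complex^3) \<Rightarrow> (real^3 \<Rightarrow> complex^3) \<Rightarrow> complex" where
  "L2_inner \<Omega> a b = (LINT x|lebesgue_on \<Omega>. (\<Sum>i\<in>UNIV. a x $ i * cnj (b x $ i)))"

text \<open>The minimum of a field defined only up to null sets is understood as its essential infimum
  over \<open>\<Omega>\<close>: a pointwise minimum could be changed at a single point without affecting any
  almost-everywhere condition. By the convention of \<open>esssup\<close> it is \<open>-\<infinity>\<close> for a non-measurable \<open>f\<close>.\<close>

definition ess_inf :: "(real^3) set \<Rightarrow> (real^3 \<Rightarrow> real) \<Rightarrow> ereal" where
  "ess_inf \<Omega> f = - esssup (lebesgue_on \<Omega>) (\<lambda>x. - ereal (f x))"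

primrec Ck :: "nat \<Rightarrow> (real^3 \<Rightarrow> complex^3) \<Rightarrow> bool" where
  "Ck 0 f \<longleftrightarrow> continuous_on UNIV f"
| "Ck (Suc k) f \<longleftrightarrow> (\<forall>x. f differentiable (at x)) \<and>
     (\<forall>h. Ck k (\<lambda>x. frechet_derivative f (at x) h))"

definition smooth_fields :: "(real^3 \<Rightarrow> complex^3) set" where
  "smooth_fields = {f. \<forall>k. Ck k f}"

definition test_fields :: "(real^3) set \<Rightarrow> (real^3 \<Rightarrow> complex^3) set" where
  "test_fields \<Omega> = {f \<in> smooth_fields.
     compact (closure {x. f x \<noteq> 0}) \<and> closure {x. f x \<noteq> 0} \<subseteq> \<Omega>}"

definition pderiv_field :: "3 \<Rightarrow> (real^3 \<Rightarrow> complex^3) \<Rightarrow> real^3 \<Rightarrow> complex^3" where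
  "pderiv_field j f x = frechet_derivative f (at x) (axis j 1)"

definition classical_curl :: "(real^3 \<Rightarrow> complex^3) \<Rightarrow> real^3 \<Rightarrow> complex^3" where
  "classical_curl f x = vector
     [pderiv_field 2 f x $ 3 - pderiv_field 3 f x $ 2,
      pderiv_field 3 f x $ 1 - pderiv_field 1 f x $ 3,
      pderiv_field 1 f x $ 2 - pderiv_field 2 f x $ 1]"

text \<open>The curl in the sense of distributions, when it is an \<open>L\<^sup>2\<close> field.\<close>

definition has_weak_curl :: "(real^3) set \<Rightarrow> (real^3 \<Rightarrow> complex^3) \<Rightarrow> (real^3 \<Rightarrow> complex^3) \<Rightarrow> bool" where
  "has_weak_curl \<Omega> v w \<longleftrightarrow> w \<in> L2 \<Omega> \<and>
     (\<forall>f\<in>test_fields \<Omega>. L2_inner \<Omega> w f = L2_inner \<Omega> v (classical_curl f))"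

text \<open>The weak curl is unique only up to null sets; \<open>curl\<close> selects a representative.\<close>

definition curl :: "(real^3) set \<Rightarrow> (real^3 \<Rightarrow> complex^3) \<Rightarrow> real^3 \<Rightarrow> complex^3" where
  "curl \<Omega> v = (SOME w. has_weak_curl \<Omega> v w)"

definition Hcurl :: "(real^3) set \<Rightarrow> (real^3 \<Rightarrow> complex^3) set" where
  "Hcurl \<Omega> = {v \<in> L2 \<Omega>. \<exists>w. has_weak_curl \<Omega> v w}"

definition Hcurl_norm :: "(real^3) set \<Rightarrow> (real^3 \<Rightarrow> complex^3) \<Rightarrow> real" where
  "Hcurl_norm \<Omega> v = sqrt ((L2_norm \<Omega> v)\<^sup>2 + (L2_norm \<Omega> (curl \<Omega> v))\<^sup>2)"

text \<open>For \<open>v\<close> in \<open>H(curl, \<Omega>)\<close> the tangential trace \<open>v \<times> n\<close> on \<open>\<Gamma>\<close> is a functional, defined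
  through Green's formula \<open>\<integral>\<^sub>\<Gamma> (v \<times> n) \<cdot> cnj f = (v, curl f) - (curl v, f)\<close>. It is tested here
  against fields \<open>f\<close> smooth up to the boundary, which are dense in \<open>H\<^sup>1(\<Omega>)\<^sup>3\<close> since \<open>\<Gamma>\<close> is
  Lipschitz.\<close>

definition tangential_trace :: "(real^3) set \<Rightarrow> (real^3 \<Rightarrow> complex^3) \<Rightarrow> (real^3 \<Rightarrow> complex^3) \<Rightarrow> complex" where
  "tangential_trace \<Omega> v f = L2_inner \<Omega> v (classical_curl f) - L2_inner \<Omega> (curl \<Omega> v) f"

definition Hcurl0 :: "(real^3) set \<Rightarrow> (real^3 \<Rightarrow> complex^3) set" where
  "Hcurl0 \<Omega> = {v \<in> Hcurl \<Omega>. \<forall>f\<in>smooth_fields. tangential_trace \<Omega> v f = 0}"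

definition ellipticity_direction :: "(real^3) set \<Rightarrow> (real^3 \<Rightarrow> complex) \<Rightarrow> real \<Rightarrow> bool" where
  "ellipticity_direction \<Omega> \<xi> \<theta> \<longleftrightarrow>
     (\<exists>\<xi>m>0. AE x in lebesgue_on \<Omega>. Re (exp (\<i> * complex_of_real \<theta>) * \<xi> x) \<ge> \<xi>m)"

definition elliptic :: "(real^3) set \<Rightarrow> (real^3 \<Rightarrow> complex) \<Rightarrow> bool" where
  "elliptic \<Omega> \<xi> \<longleftrightarrow> \<xi> \<in> Linf \<Omega> \<and> (\<exists>\<theta>. ellipticity_direction \<Omega> \<xi> \<theta>)"

definition ellipticity_directions :: "(real^3) set \<Rightarrow> (real^3 \<Rightarrow> complex) \<Rightarrow> real set" where
  "ellipticity_directions \<Omega> \<xi> = {\<theta> \<in> {-pi..pi}. ellipticity_direction \<Omega> \<xi> \<theta>}"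

definition coercive ::
  "(real^3 \<Rightarrow> complex^3) set \<Rightarrow> ((real^3 \<Rightarrow> complex^3) \<Rightarrow> real) \<Rightarrow>
   ((real^3 \<Rightarrow> complex^3) \<Rightarrow> (real^3 \<Rightarrow> complex^3) \<Rightarrow> complex) \<Rightarrow> real \<Rightarrow> bool" where
  "coercive V normV a \<theta> \<longleftrightarrow>
     (\<exists>C>0. \<forall>u\<in>V. Re (- exp (\<i> * complex_of_real \<theta>) * a u u) \<ge> C * (normV u)\<^sup>2)"

definition complex_permittivity ::
  "real \<Rightarrow> (real^3 \<Rightarrow> real) \<Rightarrow> (real^3 \<Rightarrow> real) \<Rightarrow> real^3 \<Rightarrow> complex" where
  "complex_permittivity \<omega> \<epsilon> \<sigma> x =
     complex_of_real (\<epsilon> x) + \<i> * complex_of_real (\<sigma> x) / complex_of_real \<omega>"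

definition maxwell_form ::
  "(real^3) set \<Rightarrow> real \<Rightarrow> (real^3 \<Rightarrow> complex) \<Rightarrow> (real^3 \<Rightarrow> real) \<Rightarrow>
   (real^3 \<Rightarrow> complex^3) \<Rightarrow> (real^3 \<Rightarrow> complex^3) \<Rightarrow> complex" where
  "maxwell_form \<Omega> \<omega> \<epsilon>c \<mu> u v =
     L2_inner \<Omega> (\<lambda>x. complex_of_real (inverse (\<mu> x)) *s curl \<Omega> u x) (curl \<Omega> v)
     - (complex_of_real \<omega>)\<^sup>2 * L2_inner \<Omega> (\<lambda>x. \<epsilon>c x *s u x) v"

text \<open>\<open>\<Theta>\<^sub>c\<^sub>o\<^sub>e\<close>, the intersection of the direction sets of \<open>\<epsilon>\<^sub>c\<close> and \<open>-\<mu>\<^sup>-\<^sup>1\<close>.\<close>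

definition coercivity_directions ::
  "(real^3) set \<Rightarrow> (real^3 \<Rightarrow> complex) \<Rightarrow> (real^3 \<Rightarrow> real) \<Rightarrow> real set" where
  "coercivity_directions \<Omega> \<epsilon>c \<mu> =
     ellipticity_directions \<Omega> \<epsilon>c \<inter>
     ellipticity_directions \<Omega> (\<lambda>x. - complex_of_real (inverse (\<mu> x)))"

end

theory Submission imports Defs begin

text \<open>For \<open>\<theta>\<close> in both direction sets, \<open>Re (- e\<^sup>i\<^sup>\<theta> a(u,u))\<close> is the sum of two weighted \<open>L\<^sup>2\<close> norms, of
  \<open>curl u\<close> and of \<open>u\<close>, whose weights \<open>Re (- e\<^sup>i\<^sup>\<theta> \<mu>\<^sup>-\<^sup>1)\<close> and \<open>\<omega>\<^sup>2 Re (e\<^sup>i\<^sup>\<theta> \<epsilon>\<^sub>c)\<close> are bounded below.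
  The directions of \<open>-\<mu>\<^sup>-\<^sup>1\<close> are those with \<open>cos \<theta> < 0\<close>, and \<open>\<theta>\<close> is a direction of \<open>\<epsilon>\<^sub>c\<close> iff
  \<open>cos (\<theta> + \<phi>)\<close> has a positive essential lower bound; both amount to explicit conditions
  on \<open>\<theta>\<close>.\<close>

section \<open>Polar form and modulus of elliptic fields\<close>

lemma ellipticity_direction_polar:
  assumes "AE x in lebesgue_on \<Omega>. \<xi> x = complex_of_real (cmod (\<xi> x)) * exp (\<i> * complex_of_real (\<phi> x))"
  shows "AE x in lebesgue_on \<Omega>. Re (exp (\<i> * complex_of_real \<theta>) * \<xi> x) = cmod (\<xi> x) * cos (\<theta> + \<phi> x)"
  using assms
proof (rule eventually_mono)
  fix x
  assume eq: "\<xi> x = complex_of_real (cmod (\<xi> x)) * exp (\<i> * complex_of_real (\<phi> x))"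
  have "exp (\<i> * complex_of_real \<theta>) * \<xi> x
      = complex_of_real (cmod (\<xi> x)) * cis (\<theta> + \<phi> x)"
    by (subst eq) (simp add: cis_conv_exp[symmetric] cis_mult[symmetric])
  then show "Re (exp (\<i> * complex_of_real \<theta>) * \<xi> x) = cmod (\<xi> x) * cos (\<theta> + \<phi> x)"
    by simp
qed

text \<open>Rotation by \<open>exp (\<i> * \<theta>)\<close> keeps the modulus, and a real part
  never exceeds it. For \<mu> this bounds the inverse; for \<open>\<epsilon>c\<close> it turns
  bounds on a cosine into ellipticity bounds.\<close>

lemma elliptic_norm_lower_bound:
  assumes "elliptic \<Omega> \<xi>"
  obtains c where "c > 0" "AE x in lebesgue_on \<Omega>. c \<le> cmod (\<xi> x)"
proof -
  obtain \<theta> c where c: "c > 0"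
    and ae: "AE x in lebesgue_on \<Omega>. c \<le> Re (exp (\<i> * complex_of_real \<theta>) * \<xi> x)"
    using assms unfolding elliptic_def ellipticity_direction_def by blast
  have "AE x in lebesgue_on \<Omega>. c \<le> cmod (\<xi> x)"
    using ae
  proof (rule eventually_mono)
    fix x assume "c \<le> Re (exp (\<i> * complex_of_real \<theta>) * \<xi> x)"
    also have "\<dots> \<le> cmod (exp (\<i> * complex_of_real \<theta>) * \<xi> x)"
      by (rule complex_Re_le_cmod)
    finally show "c \<le> cmod (\<xi> x)"
      by (simp add: norm_mult)
  qed
  with c show thesis by (rule that)
qed

section \<open>Weighted L2 bounds and coercivity\<close>

lemma inner_scaled_self:
  fixes v :: "complex^'n"
  shows "(\<Sum>i\<in>UNIV. (z *s v) $ i * cnj (v $ i)) = z * complex_of_real ((norm v)\<^sup>2)"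
proof -
  have "(norm v)\<^sup>2 = (\<Sum>i\<in>UNIV. (cmod (v $ i))\<^sup>2)"
    by (simp add: norm_vec_def L2_set_def sum_nonneg)
  then show ?thesis
    by (simp add: sum_distrib_left mult.assoc complex_norm_square del: of_real_power)
qed

text \<open>The integrand is \<xi> times the squared norm of \<open>v\<close>, so a pointwise lower
  bound on the rotated weight integrates to a lower bound on the form.\<close>

lemma Re_L2_inner_scaled_ge:
  assumes \<xi>: "\<xi> \<in> Linf \<Omega>" and v: "v \<in> L2 \<Omega>"
    and ae: "AE x in lebesgue_on \<Omega>. c \<le> Re (z * \<xi> x)"
  shows "c * (L2_norm \<Omega> v)\<^sup>2 \<le> Re (z * L2_inner \<Omega> (\<lambda>x. \<xi> x *s v x) v)"
proof -
  let ?M = "lebesgue_on \<Omega>"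
  from \<xi> obtain C where [measurable]: "\<xi> \<in> borel_measurable ?M"
    and C: "AE x in ?M. norm (\<xi> x) \<le> C"
    unfolding Linf_def by auto
  from v have int_v: "integrable ?M (\<lambda>x. (norm (v x))\<^sup>2)"
    and [measurable]: "v \<in> borel_measurable ?M"
    unfolding L2_def by auto
  \<comment> \<open>Essential boundedness of \<xi> enters here. Without integrability the integral
    would take the default value 0 and the comparison would be lost.\<close>
  have int: "integrable ?M (\<lambda>x. \<xi> x * complex_of_real ((norm (v x))\<^sup>2))"
  proof (rule Bochner_Integration.integrable_bound)
    show "integrable ?M (\<lambda>x. C * (norm (v x))\<^sup>2)"
      using int_v by simp
    show "AE x in ?M. norm (\<xi> x * complex_of_real ((norm (v x))\<^sup>2)) \<le> norm (C * (norm (v x))\<^sup>2)"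
      using C
      by (rule eventually_mono)
        (auto simp: norm_mult norm_power abs_mult intro!: mult_right_mono)
  qed measurable
  have int_z: "integrable ?M (\<lambda>x. z * (\<xi> x * complex_of_real ((norm (v x))\<^sup>2)))"
    using int by (rule integrable_mult_right)
  have "c * (L2_norm \<Omega> v)\<^sup>2 = (LINT x|?M. c * (norm (v x))\<^sup>2)"
    by (simp add: L2_norm_def)
  also have "\<dots> \<le> (LINT x|?M. Re (z * (\<xi> x * complex_of_real ((norm (v x))\<^sup>2))))"
  proof (rule integral_mono_AE)
    show "AE x in ?M. c * (norm (v x))\<^sup>2 \<le> Re (z * (\<xi> x * complex_of_real ((norm (v x))\<^sup>2)))"
      using ae
    proof (rule eventually_mono)
      fix x assume "c \<le> Re (z * \<xi> x)"
      then have "c * (norm (v x))\<^sup>2 \<le> Re (z * \<xi> x) * (norm (v x))\<^sup>2"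
        by (rule mult_right_mono) simp
      also have "\<dots> = Re (z * \<xi> x * complex_of_real ((norm (v x))\<^sup>2))"
        by (simp only: Re_complex_of_real Im_complex_of_real times_complex.sel mult_zero_right diff_zero)
      finally show "c * (norm (v x))\<^sup>2 \<le> Re (z * (\<xi> x * complex_of_real ((norm (v x))\<^sup>2)))"
        by (simp only: mult.assoc)
    qed
  qed (use int_v integrable_Re[OF int_z] in simp_all)
  also have "\<dots> = Re (z * L2_inner \<Omega> (\<lambda>x. \<xi> x *s v x) v)"
    unfolding L2_inner_def inner_scaled_self
    by (simp only: integral_Re[OF int_z] Bochner_Integration.integral_mult_right_zero)
  finally show ?thesis .
qed

text \<open>Membership in \<open>Hcurl\<close> supplies a witness, so the choice in
  \<open>curl\<close> picks a genuine weak curl.\<close>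

lemma curl_in_L2:
  assumes "v \<in> Hcurl \<Omega>"
  shows "curl \<Omega> v \<in> L2 \<Omega>"
proof -
  from assms have "has_weak_curl \<Omega> v (curl \<Omega> v)"
    unfolding Hcurl_def curl_def by (blast intro: someI[where P = "has_weak_curl \<Omega> v"])
  then show ?thesis by (simp add: has_weak_curl_def)
qed

lemma coercive_maxwell_form:
  assumes \<omega>: "\<omega> > 0" and \<xi>: "\<xi> \<in> Linf \<Omega>"
    and \<nu>: "(\<lambda>x. complex_of_real (inverse (\<mu> x))) \<in> Linf \<Omega>"
    and \<theta>: "\<theta> \<in> coercivity_directions \<Omega> \<xi> \<mu>"
  shows "coercive (Hcurl \<Omega>) (Hcurl_norm \<Omega>) (maxwell_form \<Omega> \<omega> \<xi> \<mu>) \<theta>"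
proof -
  let ?e = "exp (\<i> * complex_of_real \<theta>)"
  let ?\<nu> = "\<lambda>x. complex_of_real (inverse (\<mu> x))"
  obtain c d where c: "c > 0" "AE x in lebesgue_on \<Omega>. c \<le> Re (?e * \<xi> x)"
    and d: "d > 0" "AE x in lebesgue_on \<Omega>. d \<le> Re (?e * - ?\<nu> x)"
    using \<theta> unfolding coercivity_directions_def ellipticity_directions_def ellipticity_direction_def
    by blast
  \<comment> \<open>The smaller of the two lower bounds serves both terms of the squared graph
    norm.\<close>
  define C where "C = min (\<omega>\<^sup>2 * c) d"
  have "C > 0"
    using c(1) d(1) \<omega> by (simp add: C_def)
  moreover have "C * (Hcurl_norm \<Omega> u)\<^sup>2 \<le> Re (- ?e * maxwell_form \<Omega> \<omega> \<xi> \<mu> u u)"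
    if u: "u \<in> Hcurl \<Omega>" for u
  proof -
    have "u \<in> L2 \<Omega>"
      using u by (simp add: Hcurl_def)
    then have "\<omega>\<^sup>2 * (c * (L2_norm \<Omega> u)\<^sup>2) \<le> \<omega>\<^sup>2 * Re (?e * L2_inner \<Omega> (\<lambda>x. \<xi> x *s u x) u)"
      by (intro mult_left_mono Re_L2_inner_scaled_ge \<xi> c(2)) auto
    moreover have "d * (L2_norm \<Omega> (curl \<Omega> u))\<^sup>2
        \<le> Re (- ?e * L2_inner \<Omega> (\<lambda>x. ?\<nu> x *s curl \<Omega> u x) (curl \<Omega> u))"
      \<comment> \<open>The sign of the weight moves into the rotation, which becomes
        \<open>- ?e\<close>.\<close>
      using d(2) by (intro Re_L2_inner_scaled_ge \<nu> curl_in_L2 u) simp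
    moreover have "C * (L2_norm \<Omega> u)\<^sup>2 \<le> \<omega>\<^sup>2 * c * (L2_norm \<Omega> u)\<^sup>2"
      "C * (L2_norm \<Omega> (curl \<Omega> u))\<^sup>2 \<le> d * (L2_norm \<Omega> (curl \<Omega> u))\<^sup>2"
      by (auto simp: C_def intro!: mult_right_mono)
    moreover have "Re (- ?e * maxwell_form \<Omega> \<omega> \<xi> \<mu> u u)
        = Re (- ?e * L2_inner \<Omega> (\<lambda>x. ?\<nu> x *s curl \<Omega> u x) (curl \<Omega> u))
          + \<omega>\<^sup>2 * Re (?e * L2_inner \<Omega> (\<lambda>x. \<xi> x *s u x) u)"
    proof -
      have "- ?e * maxwell_form \<Omega> \<omega> \<xi> \<mu> u u
        = - ?e * L2_inner \<Omega> (\<lambda>x. ?\<nu> x *s curl \<Omega> u x) (curl \<Omega> u)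
          + complex_of_real (\<omega>\<^sup>2) * (?e * L2_inner \<Omega> (\<lambda>x. \<xi> x *s u x) u)"
        by (simp add: maxwell_form_def algebra_simps)
      then show ?thesis
        by (simp only: plus_complex.sel Re_complex_of_real Im_complex_of_real times_complex.sel(1)[of "complex_of_real _"])
    qed
    moreover have "(Hcurl_norm \<Omega> u)\<^sup>2 = (L2_norm \<Omega> u)\<^sup>2 + (L2_norm \<Omega> (curl \<Omega> u))\<^sup>2"
      by (simp add: Hcurl_norm_def)
    ultimately show ?thesis
      by (simp add: distrib_left mult.assoc)
  qed
  ultimately show ?thesis
    unfolding coercive_def by blast
qed

lemma coercive_subset:
  assumes "coercive V N a \<theta>" "W \<subseteq> V"
  shows "coercive W N a \<theta>"
  using assms unfolding coercive_def by blast

section \<open>Essential infimum\<close>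

lemma ereal_le_ess_inf:
  assumes "\<phi> \<in> borel_measurable (lebesgue_on \<Omega>)" "AE x in lebesgue_on \<Omega>. c \<le> \<phi> x"
  shows "ereal c \<le> ess_inf \<Omega> \<phi>"
proof -
  have "esssup (lebesgue_on \<Omega>) (\<lambda>x. - ereal (\<phi> x)) \<le> - ereal c"
    using assms by (intro esssup_I) auto
  then show ?thesis
    unfolding ess_inf_def using ereal_minus_le_minus[of "- ereal c"] by simp
qed

text \<open>For a non-measurable function \<open>esssup\<close> defaults to \<open>top\<close>,
  which makes \<open>ess_inf\<close> minus infinity; a finite value therefore certifies
  measurability.\<close>

lemma ess_inf_real_imp_measurable:
  assumes "ess_inf \<Omega> \<phi> = ereal r"
  shows "\<phi> \<in> borel_measurable (lebesgue_on \<Omega>)"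
proof -
  have "(\<lambda>x. - ereal (\<phi> x)) \<in> borel_measurable (lebesgue_on \<Omega>)"
  proof (rule ccontr)
    assume "\<not> ?thesis"
    then have "ess_inf \<Omega> \<phi> = - top"
      unfolding ess_inf_def by (subst esssup_non_measurable) auto
    with assms show False by (simp add: top_ereal_def)
  qed
  then have "(\<lambda>x. real_of_ereal (- (- ereal (\<phi> x)))) \<in> borel_measurable (lebesgue_on \<Omega>)"
    by measurable
  then show ?thesis by simp
qed

theorem proposition5p1:
  fixes \<Omega> :: "(real^3) set" and \<omega> :: real
    and \<epsilon> \<mu> \<sigma> \<phi> :: "real^3 \<Rightarrow> real" and \<epsilon>c :: "real^3 \<Rightarrow> complex"
    and \<phi>m \<phi>p :: real
  assumes "open \<Omega>" and "connected \<Omega>" and "bounded \<Omega>" and "lipschitz_boundary \<Omega>"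
    and "\<omega> > 0"
    and "\<epsilon> \<in> Linf \<Omega>" and "\<mu> \<in> Linf \<Omega>" and "\<sigma> \<in> Linf \<Omega>"
    and "AE x in lebesgue_on \<Omega>. \<epsilon> x > 0 \<and> \<mu> x > 0 \<and> \<sigma> x > 0"
    and "\<epsilon>c = complex_permittivity \<omega> \<epsilon> \<sigma>"
    and "AE x in lebesgue_on \<Omega>. \<phi> x \<in> {0<..<pi/2} \<and>
           \<epsilon>c x = complex_of_real (cmod (\<epsilon>c x)) * exp (\<i> * complex_of_real (\<phi> x))"
    and "elliptic \<Omega> \<epsilon>c" and "elliptic \<Omega> (\<lambda>x. complex_of_real (\<mu> x))"
    and "0 < \<phi>m" and "\<phi>m \<le> \<phi>p" and "\<phi>p < pi/2"
    and "AE x in lebesgue_on \<Omega>. \<phi> x \<in> {\<phi>m..\<phi>p}"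
  shows "(\<forall>\<theta>\<in>coercivity_directions \<Omega> \<epsilon>c \<mu>.
            coercive (Hcurl0 \<Omega>) (Hcurl_norm \<Omega>) (maxwell_form \<Omega> \<omega> \<epsilon>c \<mu>) \<theta> \<and>
            coercive (Hcurl \<Omega>) (Hcurl_norm \<Omega>) (maxwell_form \<Omega> \<omega> \<epsilon>c \<mu>) \<theta>)
       \<and> coercivity_directions \<Omega> \<epsilon>c \<mu> \<supseteq> {-pi/2 - \<phi>m<..<-pi/2}
       \<and> (ereal \<phi>m = ess_inf \<Omega> \<phi> \<longrightarrow>
            coercivity_directions \<Omega> \<epsilon>c \<mu> = {-pi/2 - \<phi>m<..<-pi/2})"
proof -
  have \<xi>_Linf: "\<epsilon>c \<in> Linf \<Omega>"
    using assms(12) by (simp add: elliptic_def)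
  obtain M\<mu> where M\<mu>: "AE x in lebesgue_on \<Omega>. norm (\<mu> x) \<le> M\<mu>"
    and \<mu>_meas[measurable]: "\<mu> \<in> borel_measurable (lebesgue_on \<Omega>)"
    using assms(7) unfolding Linf_def by blast
  obtain M where M: "AE x in lebesgue_on \<Omega>. cmod (\<epsilon>c x) \<le> M"
    using \<xi>_Linf unfolding Linf_def by blast
  obtain m\<mu> where m\<mu>: "m\<mu> > 0" "AE x in lebesgue_on \<Omega>. m\<mu> \<le> cmod (complex_of_real (\<mu> x))"
    using assms(13) by (rule elliptic_norm_lower_bound)
  obtain m where m: "m > 0" "AE x in lebesgue_on \<Omega>. m \<le> cmod (\<epsilon>c x)"
    using assms(12) by (rule elliptic_norm_lower_bound)
  have polar: "AE x in lebesgue_on \<Omega>.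
      Re (exp (\<i> * complex_of_real \<theta>) * \<epsilon>c x) = cmod (\<epsilon>c x) * cos (\<theta> + \<phi> x)" for \<theta>
    by (rule ellipticity_direction_polar) (use assms(11) in eventually_elim, simp)
  have Re_\<nu>: "Re (exp (\<i> * complex_of_real \<theta>) * - complex_of_real (inverse (\<mu> x)))
      = - cos \<theta> * inverse (\<mu> x)" for \<theta> x
    by (simp add: cis_conv_exp[symmetric] flip: of_real_inverse)
  have \<nu>_Linf: "(\<lambda>x. complex_of_real (inverse (\<mu> x))) \<in> Linf \<Omega>"
  proof -
    have "AE x in lebesgue_on \<Omega>. norm (complex_of_real (inverse (\<mu> x))) \<le> inverse m\<mu>"
      using m\<mu>(2) by eventually_elim (use m\<mu>(1) in \<open>simp add: norm_inverse le_imp_inverse_le\<close>)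
    then show ?thesis
      unfolding Linf_def by auto
  qed
  have coe: "coercive (Hcurl \<Omega>) (Hcurl_norm \<Omega>) (maxwell_form \<Omega> \<omega> \<epsilon>c \<mu>) \<theta>"
    if "\<theta> \<in> coercivity_directions \<Omega> \<epsilon>c \<mu>" for \<theta>
    using assms(5) \<xi>_Linf \<nu>_Linf that by (rule coercive_maxwell_form)
  moreover have "Hcurl0 \<Omega> \<subseteq> Hcurl \<Omega>"
    by (auto simp: Hcurl0_def)
  moreover have superset: "{-pi/2 - \<phi>m<..<-pi/2} \<subseteq> coercivity_directions \<Omega> \<epsilon>c \<mu>"
  proof
    fix \<theta> assume "\<theta> \<in> {-pi/2 - \<phi>m<..<-pi/2}"
    then have \<theta>: "-pi/2 - \<phi>m < \<theta>" "\<theta> < -pi/2" by auto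
    have range: "\<theta> \<in> {-pi..pi}"
      using \<theta> assms(14-16) by auto
    have cos\<theta>: "cos \<theta> < 0"
    proof -
      \<comment> \<open>Since \<theta> lies between -pi and -pi/2, the shift by pi, which flips the
        sign of the cosine, lands where the cosine is positive.\<close>
      have "0 < cos (\<theta> + pi)"
        using \<theta> range by (intro cos_gt_zero_pi) auto
      then show ?thesis by simp
    qed
    have cos_m: "0 < cos (\<theta> + \<phi>m)"
      using \<theta> assms(14-16) by (intro cos_gt_zero_pi) auto
    have "AE x in lebesgue_on \<Omega>. m * cos (\<theta> + \<phi>m) \<le> Re (exp (\<i> * complex_of_real \<theta>) * \<epsilon>c x)"
      using polar[of \<theta>] m(2) assms(17)
    proof eventually_elim
      case (elim x)
      \<comment> \<open>The two angles lie in [-pi, 0], where the cosine increases, so the smallest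
        phase \<phi>m is the worst case.\<close>
      have "cos (\<theta> + \<phi>m) \<le> cos (\<theta> + \<phi> x)"
        using \<theta> elim(3) assms(14-16) range by (intro cos_monotone_minus_pi_0') auto
      then show ?case
        unfolding elim(1) using elim(2) m(1) cos_m by (intro mult_mono) auto
    qed
    then have "ellipticity_direction \<Omega> \<epsilon>c \<theta>"
      unfolding ellipticity_direction_def using m(1) cos_m by (intro exI[of _ "m * cos (\<theta> + \<phi>m)"]) simp
    \<comment> \<open>The bound \<open>M\<mu>\<close> carries no sign; the maximum with 1 makes the
      constant positive.\<close>
    moreover have "AE x in lebesgue_on \<Omega>. - cos \<theta> * inverse (max 1 M\<mu>)
        \<le> Re (exp (\<i> * complex_of_real \<theta>) * - complex_of_real (inverse (\<mu> x)))"
      using M\<mu> assms(9)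
    proof eventually_elim
      case (elim x)
      then have "inverse (max 1 M\<mu>) \<le> inverse (\<mu> x)"
        by (intro le_imp_inverse_le) auto
      then show ?case
        unfolding Re_\<nu> using cos\<theta> by (intro mult_left_mono) auto
    qed
    then have "ellipticity_direction \<Omega> (\<lambda>x. - complex_of_real (inverse (\<mu> x))) \<theta>"
      unfolding ellipticity_direction_def
      using cos\<theta> by (intro exI[of _ "- cos \<theta> * inverse (max 1 M\<mu>)"]) (auto simp: mult_less_0_iff)
    ultimately show "\<theta> \<in> coercivity_directions \<Omega> \<epsilon>c \<mu>"
      using range by (simp add: coercivity_directions_def ellipticity_directions_def)
  qed
  moreover have "coercivity_directions \<Omega> \<epsilon>c \<mu> \<subseteq> {-pi/2 - \<phi>m<..<-pi/2}"
    if inf: "ereal \<phi>m = ess_inf \<Omega> \<phi>"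
  proof
    fix \<theta> assume "\<theta> \<in> coercivity_directions \<Omega> \<epsilon>c \<mu>"
    then obtain c d where range: "\<theta> \<in> {-pi..pi}"
      and c: "c > 0" "AE x in lebesgue_on \<Omega>. c \<le> Re (exp (\<i> * complex_of_real \<theta>) * \<epsilon>c x)"
      and d: "d > 0" "AE x in lebesgue_on \<Omega>.
        d \<le> Re (exp (\<i> * complex_of_real \<theta>) * - complex_of_real (inverse (\<mu> x)))"
      unfolding coercivity_directions_def ellipticity_directions_def ellipticity_direction_def
      by blast
    have meas: "\<phi> \<in> borel_measurable (lebesgue_on \<Omega>)"
      using inf by (metis ess_inf_real_imp_measurable)
    \<comment> \<open>This is the maximality of \<phi>m among essential lower bounds, the form in
      which the minimum hypothesis is used below.\<close>
    have lower: "b \<le> \<phi>m" if "AE x in lebesgue_on \<Omega>. b \<le> \<phi> x" for b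
      using ereal_le_ess_inf[OF meas that] inf[symmetric] by simp
    \<comment> \<open>On a null domain every property holds almost everywhere, even
      \<open>\<phi>m + 1 \<le> \<phi> x\<close>, against \<open>lower\<close>. So almost-everywhere
      facts have actual witnesses.\<close>
    have nonnull: "\<exists>x. P x" if "AE x in lebesgue_on \<Omega>. P x" for P
    proof (rule ccontr)
      assume no: "\<nexists>x. P x"
      have "AE x in lebesgue_on \<Omega>. \<phi>m + 1 \<le> \<phi> x"
        using that by (rule eventually_mono) (use no in blast)
      from lower[OF this] show False by simp
    qed
    have "cos \<theta> < 0"
    proof (rule ccontr)
      assume "\<not> cos \<theta> < 0"
      moreover obtain x where x: "d \<le> - cos \<theta> * inverse (\<mu> x)" "\<mu> x > 0"
        using nonnull[OF eventually_conj[OF d(2) assms(9)]] unfolding Re_\<nu> by blast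
      ultimately have "0 \<le> cos \<theta> * inverse (\<mu> x)" by simp
      with x(1) d(1) show False by simp
    qed
    have \<theta>_abs: "\<theta> < -pi/2 \<or> pi/2 < \<theta>"
    proof (rule ccontr)
      assume "\<not> ?thesis"
      then have "0 \<le> cos \<theta>" by (intro cos_ge_zero) auto
      with \<open>cos \<theta> < 0\<close> show False by simp
    qed
    \<comment> \<open>Dividing by an upper bound of the modulus gives a uniform positive gap, not
      mere positivity; the strict inequality at the left endpoint rests on it.\<close>
    have cos_pos: "AE x in lebesgue_on \<Omega>. c / max 1 M \<le> cos (\<theta> + \<phi> x)"
      using polar[of \<theta>] c(2) M
    proof eventually_elim
      case (elim x)
      then have le: "c \<le> cmod (\<epsilon>c x) * cos (\<theta> + \<phi> x)" by simp
      with c(1) have "0 < cos (\<theta> + \<phi> x)"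
        by (smt (verit) mult_nonneg_nonpos norm_ge_zero)
      then have "cmod (\<epsilon>c x) * cos (\<theta> + \<phi> x) \<le> max 1 M * cos (\<theta> + \<phi> x)"
        using elim(3) by (intro mult_right_mono) auto
      with le show ?case by (simp add: divide_le_eq mult.commute)
    qed
    have c': "0 < c / max 1 M" using c(1) by simp
    \<comment> \<open>The other arc is impossible: for \<theta> in ]pi/2, pi] and a phase in ]0,
      pi/2[ the sum lies in ]pi/2, 3*pi/2[, where the cosine is negative.\<close>
    have "\<theta> < -pi/2"
    proof (rule ccontr)
      assume "\<not> \<theta> < -pi/2"
      with \<theta>_abs have "pi/2 < \<theta>" by simp
      obtain x where x: "c / max 1 M \<le> cos (\<theta> + \<phi> x)" "\<phi> x \<in> {0<..<pi/2}"
        using nonnull[OF eventually_conj[OF cos_pos assms(11)]] by blast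
      have "0 < cos (\<theta> + \<phi> x - pi)"
        using x(2) \<open>pi/2 < \<theta>\<close> range by (intro cos_gt_zero_pi) auto
      with x(1) c' show False by simp
    qed
    moreover have "-pi/2 - \<phi>m < \<theta>"
    proof -
      \<comment> \<open>The inequality sin t \<le> t, at t = \<theta> + \<phi> x + pi/2, turns the
        gap in the cosine into an equal gap in the phase. Comparison with \<phi>m through
        \<open>lower\<close> is then strict.\<close>
      have "AE x in lebesgue_on \<Omega>. c / max 1 M - pi/2 - \<theta> \<le> \<phi> x"
        using cos_pos assms(11)
      proof eventually_elim
        case (elim x)
        have sin_eq: "sin (\<theta> + \<phi> x + pi/2) = cos (\<theta> + \<phi> x)"
          by (simp add: sin_add)
        \<comment> \<open>The bound on the sine requires t \<ge> 0. Here t > -pi/2, so a negative t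
          would make the sine, hence the cosine in \<open>cos_pos\<close>, negative.\<close>
        have "0 \<le> \<theta> + \<phi> x + pi/2"
        proof (rule ccontr)
          assume "\<not> ?thesis"
          then have "0 < sin (- (\<theta> + \<phi> x + pi/2))"
            using elim(2) range by (intro sin_gt_zero) auto
          then have "cos (\<theta> + \<phi> x) < 0"
            unfolding sin_minus sin_eq by simp
          with elim(1) c' show False by simp
        qed
        then have "sin (\<theta> + \<phi> x + pi/2) \<le> \<theta> + \<phi> x + pi/2"
          by (rule sin_x_le_x)
        with elim(1) show ?case unfolding sin_eq by simp
      qed
      from lower[OF this] c' show ?thesis by simp
    qed
    ultimately show "\<theta> \<in> {-pi/2 - \<phi>m<..<-pi/2}" by simp
  qed
  ultimately show ?thesis
    using coercive_subset by blast
qed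

end
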